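(* The B-Z constant for the family of $2\times n$ grid graphs exists and equals $\sqrt{3}-\frac{3}{2}$; that is, $$\lim_{n\to\infty}\frac{\sum_{T\in\mathcal{T}(P_2\times P_n)}|\mathcal{L}(T)|}{2n\cdot\tau(P_2\times P_n)}=\sqrt{3}-\frac{3}{2}.$$
   Context: All graphs are finite and simple. The $a\times b$ grid graph $P_a\times P_b$ has vertex set $\{(i,j): 1\le i\le a,\ 1\le j\le b\}$, and $(u_1,u_2)$ and $(v_1,v_2)$ are adjacent iff either $|u_1-v_1|=1$ and $u_2=v_2$, or $u_1=v_1$ and $|u_2-v_2|=1$. $\mathcal{T}(G)$ is the set of labeled spanning trees of $G$, $\tau(G)=|\mathcal{T}(G)|$, and $\mathcal{L}(T)$ is the set of leaves (vertices of degree exactly $1$ in $T$) of a tree $T$. The B-Z constant of a graph family (with members indexed by number of vertices) is the limit of $\frac{\sum_{T\in\mathcal{T}(G)}|\mathcal{L}(T)|}{|V(G)|\,\tau(G)}$ as $|V(G)|\to\infty$ along members $G$ of the family, whenever the limit exists. *)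

theory Defs
  imports Complex_Main "Graph_Theory.Graph_Theory"
begin

text \<open>
  Finite simple graphs are rendered as finite, loop-free, symmetric digraphs whose arcs are
  pairs of vertices, that is, by the predicate \<^term>\<open>pair_graph\<close>; an undirected edge
  is a pair of opposite arcs.
\<close>

definition grid_graph :: "nat \<Rightarrow> nat \<Rightarrow> (nat \<times> nat) pair_pre_digraph" where
  "grid_graph a b =
     \<lparr> pverts = {1..a} \<times> {1..b},
       parcs = {(u, v). u \<in> {1..a} \<times> {1..b} \<and> v \<in> {1..a} \<times> {1..b} \<and>
         (\<bar>int (fst u) - int (fst v)\<bar> = 1 \<and> snd u = snd v \<or>
          fst u = fst v \<and> \<bar>int (snd u) - int (snd v)\<bar> = 1)} \<rparr>"

lemma pair_graph_grid_graph: "pair_graph (grid_graph a b)"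
proof
  have "parcs (grid_graph a b) \<subseteq> pverts (grid_graph a b) \<times> pverts (grid_graph a b)"
    by (auto simp: grid_graph_def)
  moreover have "finite (pverts (grid_graph a b))"
    by (simp add: grid_graph_def)
  ultimately show "finite (parcs (grid_graph a b))"
    by (blast intro: finite_subset)
qed (auto simp: grid_graph_def symmetric_def sym_def)

text \<open>
  The predicates \<^const>\<open>tree\<close> and \<^const>\<open>spanning_tree\<close> of the library cannot be used
  here: their acyclicity condition \<^const>\<open>forest\<close> forbids directed cycles only.  It
  therefore rules out a pair of opposite arcs, and it admits orientations of undirected cycles.
  In a symmetric digraph without loops and parallel arcs, the cycles of the undirected graph
  are the directed cycles of length at least three.
\<close>

definition simple_tree :: "'a pair_pre_digraph \<Rightarrow> bool" where
  "simple_tree T \<longleftrightarrow> pair_graph T \<and> Digraph_Component.connected (with_proj T) \<and>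
     \<not> (\<exists>p. pre_digraph.cycle (with_proj T) p \<and> 3 \<le> length p)"

definition spanning_trees :: "'a pair_pre_digraph \<Rightarrow> 'a pair_pre_digraph set" where
  "spanning_trees G = {T. simple_tree T \<and> spanning (with_proj T) (with_proj G)}"

text \<open>In a symmetric digraph, the out-degree is the degree of the undirected graph.\<close>

definition leaves :: "'a pair_pre_digraph \<Rightarrow> 'a set" where
  "leaves T = {v \<in> pverts T. out_degree (with_proj T) v = 1}"

definition BZ_ratio :: "'a pair_pre_digraph \<Rightarrow> real" where
  "BZ_ratio G = real (\<Sum>T\<in>spanning_trees G. card (leaves T)) /
     (real (card (pverts G)) * real (card (spanning_trees G)))"

text \<open>
  The limit is taken as the number of vertices tends to infinity along the members of the
  family.  It is determined uniquely only if the family has arbitrarily large members.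
\<close>

definition has_BZ_constant :: "'a pair_pre_digraph set \<Rightarrow> real \<Rightarrow> bool" where
  "has_BZ_constant F c \<longleftrightarrow>
     (BZ_ratio \<longlongrightarrow> c) (inf (filtercomap (\<lambda>G. card (pverts G)) at_top) (principal F))"

end

theory Submission
  imports Defs
begin

text \<open>
Count pairs of a spanning tree and a leaf by the leaf instead of by the tree. A spanning tree
of \<open>G\<close> in which \<open>v\<close> is a leaf is a spanning tree of \<open>G - v\<close> with one of the
\<open>deg v\<close> edges at \<open>v\<close> added, so the total number of leaves is
\<open>\<Sum>v. deg v * \<tau>(G - v)\<close> (\<open>card_trees_leaf\<close>).

Let \<open>a n\<close> be the number of spanning trees of the ladder with \<open>n\<close> rungs. If \<open>v\<close> lies on
rung \<open>k\<close> with \<open>1 < k < n\<close>, then \<open>deg v = 3\<close>, and deleting \<open>v\<close> leaves two ladders joined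
by a path of two bridges through the other end of the rung. Spanning trees multiply over
bridges (\<open>card_trees_bridge\<close>), so \<open>v\<close> is a leaf of exactly \<open>3 * a (k - 1) * a (n - k)\<close>
spanning trees. The four corners contribute at most \<open>4 * a n\<close> altogether, which
divided by \<open>2 * n * a n\<close> tends to zero.

Appending a rung to a ladder appends a square. Recording also how many spanning trees
contain the last rung gives a linear recursion for a pair of counts
(\<open>card_trees_append_square\<close>), whose solution is
\<open>a n = (\<alpha>^n - \<beta>^n) / (2 * sqrt 3)\<close> with \<open>\<alpha> = 2 + sqrt 3\<close>, \<open>\<beta> = 2 - sqrt 3\<close> and
\<open>\<alpha> * \<beta> = 1\<close>. The convolution \<open>\<Sum>k. a k * a (n - 1 - k)\<close> is therefore explicit and
asymptotic to \<open>n * \<alpha>^(n - 1) / 12\<close>, so that six times it, divided by \<open>2 * n * a n\<close>, tends to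
\<open>sqrt 3 / (2 * \<alpha>) = sqrt 3 - 3 / 2\<close>.

All tree arguments are carried out on symmetric relations. There a graph is acyclic if and
only if each of its edges is a bridge, which reduces every surgery on trees to computing a
reflexive transitive closure.
\<close>


section \<open>Trees as symmetric relations\<close>

definition edge :: "'a \<Rightarrow> 'a \<Rightarrow> 'a rel" where
  "edge u v = {(u, v), (v, u)}"

text \<open>
Acyclicity in the form "the ends of an edge are disconnected by removing the edge": it needs
no cycles as objects, and it excludes loops because the closure is reflexive.
\<close>

definition acyclic_edges :: "'a rel \<Rightarrow> bool" where
  "acyclic_edges R \<longleftrightarrow> (\<forall>u v. (u, v) \<in> R \<longrightarrow> (u, v) \<notin> (R - edge u v)\<^sup>*)"

definition tree_on :: "'a set \<Rightarrow> 'a rel \<Rightarrow> bool" where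
  "tree_on V R \<longleftrightarrow> V \<noteq> {} \<and> R \<subseteq> V \<times> V \<and> sym R \<and> (\<forall>a\<in>V. \<forall>b\<in>V. (a, b) \<in> R\<^sup>*) \<and> acyclic_edges R"

text \<open>
The relation \<open>E\<close> may have edges outside \<open>V\<close>, which \<^const>\<open>tree_on\<close> cuts off. One
ambient relation thus serves for all its induced subgraphs.
\<close>

definition trees :: "'a set \<Rightarrow> 'a rel \<Rightarrow> 'a rel set" where
  "trees V E = {R. R \<subseteq> E \<and> tree_on V R}"

lemma finite_trees: "finite V \<Longrightarrow> finite (trees V E)"
  by (rule finite_subset[of _ "Pow (V \<times> V)"]) (auto simp: trees_def tree_on_def)

lemma edge_commute: "edge u v = edge v u"
  by (auto simp: edge_def)

lemma sym_edge [simp]: "sym (edge u v)"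
  by (auto simp: edge_def sym_def)

lemma rtrancl_edge_Un:
  "(a, b) \<in> (edge u v \<union> R)\<^sup>* \<longleftrightarrow>
     (a, b) \<in> R\<^sup>* \<or> (a, u) \<in> R\<^sup>* \<and> (v, b) \<in> R\<^sup>* \<or> (a, v) \<in> R\<^sup>* \<and> (u, b) \<in> R\<^sup>*"
proof -
  have "edge u v \<union> R = insert (u, v) (insert (v, u) R)"
    by (auto simp: edge_def)
  then show ?thesis
    by (auto simp: rtrancl_insert dest: rtrancl_trans)
qed

lemma sym_rtranclD: "sym R \<Longrightarrow> (a, b) \<in> R\<^sup>* \<Longrightarrow> (b, a) \<in> R\<^sup>*"
  by (meson sym_rtrancl symD)

lemma rtrancl_stays:
  assumes "(a, b) \<in> R\<^sup>*" "R \<subseteq> V \<times> V"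
  shows "a = b \<or> a \<in> V \<and> b \<in> V"
  using assms by (induction rule: rtrancl_induct) auto

lemma rtrancl_Un_disjoint:
  assumes "R1 \<subseteq> V1 \<times> V1" "R2 \<subseteq> V2 \<times> V2" "V1 \<inter> V2 = {}" "a \<in> V1"
  shows "(a, b) \<in> (R1 \<union> R2)\<^sup>* \<longleftrightarrow> (a, b) \<in> R1\<^sup>*"
proof
  assume "(a, b) \<in> (R1 \<union> R2)\<^sup>*"
  then have "(a, b) \<in> R1\<^sup>* \<and> b \<in> V1"
    by (induction rule: rtrancl_induct) (use assms in \<open>auto intro: rtrancl_into_rtrancl\<close>)
  then show "(a, b) \<in> R1\<^sup>*" ..
next
  assume "(a, b) \<in> R1\<^sup>*"
  then show "(a, b) \<in> (R1 \<union> R2)\<^sup>*"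
    by (meson Un_upper1 rtrancl_mono subsetD)
qed

text \<open>
Suppose that a new edge closed a cycle through an old edge. Then the rest of that cycle, together
with the old edge, would already connect the ends of the new one.
\<close>

lemma acyclic_edges_edge_Un:
  assumes "sym R" "(u, v) \<notin> R"
  shows "acyclic_edges (edge u v \<union> R) \<longleftrightarrow> acyclic_edges R \<and> (u, v) \<notin> R\<^sup>*"
proof (intro iffI conjI)
  have diff: "(edge u v \<union> R) - edge u v = R"
    using assms by (auto simp: edge_def dest: symD)
  assume ac: "acyclic_edges (edge u v \<union> R)"
  show "(u, v) \<notin> R\<^sup>*"
    using ac diff unfolding acyclic_edges_def by (metis UnI1 edge_def insertI1)
  show "acyclic_edges R"
    unfolding acyclic_edges_def
  proof (intro allI impI notI)
    fix a b assume "(a, b) \<in> R" "(a, b) \<in> (R - edge a b)\<^sup>*"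
    moreover have "(R - edge a b)\<^sup>* \<subseteq> ((edge u v \<union> R) - edge a b)\<^sup>*"
      by (rule rtrancl_mono) auto
    ultimately show False
      using ac unfolding acyclic_edges_def by blast
  qed
next
  assume "acyclic_edges R \<and> (u, v) \<notin> R\<^sup>*"
  then have ac: "acyclic_edges R" and uv: "(u, v) \<notin> R\<^sup>*" by auto
  have vu: "(v, u) \<notin> R\<^sup>*"
    using uv sym_rtranclD[OF assms(1)] by blast
  show "acyclic_edges (edge u v \<union> R)"
    unfolding acyclic_edges_def
  proof (intro allI impI notI)
    fix a b assume ab: "(a, b) \<in> edge u v \<union> R" and path: "(a, b) \<in> ((edge u v \<union> R) - edge a b)\<^sup>*"
    show False
    proof (cases "(a, b) \<in> edge u v")
      case True
      then have "(edge u v \<union> R) - edge a b = R"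
        using assms by (auto simp: edge_def dest: symD)
      then show False using path True uv vu by (auto simp: edge_def)
    next
      case False
      then have "(a, b) \<in> R" using ab by auto
      have "(edge u v \<union> R) - edge a b = edge u v \<union> (R - edge a b)"
        using False by (auto simp: edge_def)
      with path have "(a, b) \<in> (edge u v \<union> (R - edge a b))\<^sup>*"
        by simp
      then have "(a, b) \<in> (R - edge a b)\<^sup>* \<or> (a, u) \<in> R\<^sup>* \<and> (v, b) \<in> R\<^sup>* \<or> (a, v) \<in> R\<^sup>* \<and> (u, b) \<in> R\<^sup>*"
        using rtrancl_mono[of "R - edge a b" R] unfolding rtrancl_edge_Un by auto
      moreover have "(a, b) \<notin> (R - edge a b)\<^sup>*"
        using ac \<open>(a, b) \<in> R\<close> unfolding acyclic_edges_def by blast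
      moreover have "(a, b) \<in> R\<^sup>*" "(b, a) \<in> R\<^sup>*"
        using \<open>(a, b) \<in> R\<close> assms(1) by (auto dest: symD)
      ultimately show False
        using uv vu by (meson rtrancl_trans sym_rtranclD[OF assms(1)])
    qed
  qed
qed

lemma acyclic_edges_Un_disjoint:
  assumes "R1 \<subseteq> V1 \<times> V1" "R2 \<subseteq> V2 \<times> V2" "V1 \<inter> V2 = {}"
  shows "acyclic_edges (R1 \<union> R2) \<longleftrightarrow> acyclic_edges R1 \<and> acyclic_edges R2"
proof -
  have 1: "(a, b) \<in> (R1 \<union> R2 - edge a b)\<^sup>* \<longleftrightarrow> (a, b) \<in> (R1 - edge a b)\<^sup>*" if "(a, b) \<in> R1" for a b
    using rtrancl_Un_disjoint[of "R1 - edge a b" V1 "R2 - edge a b" V2 a b] assms that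
    by (simp add: Un_Diff) blast
  have 2: "(a, b) \<in> (R1 \<union> R2 - edge a b)\<^sup>* \<longleftrightarrow> (a, b) \<in> (R2 - edge a b)\<^sup>*" if "(a, b) \<in> R2" for a b
    using rtrancl_Un_disjoint[of "R2 - edge a b" V2 "R1 - edge a b" V1 a b] assms that
    by (simp add: Un_Diff Un_commute Int_commute) blast
  show ?thesis
    unfolding acyclic_edges_def using 1 2 by auto
qed

lemma tree_on_bridge:
  assumes R: "R1 \<subseteq> V1 \<times> V1" "R2 \<subseteq> V2 \<times> V2" and dis: "V1 \<inter> V2 = {}"
    and u: "u \<in> V1" and v: "v \<in> V2" and s: "sym R1" "sym R2"
  shows "tree_on (V1 \<union> V2) (edge u v \<union> (R1 \<union> R2)) \<longleftrightarrow> tree_on V1 R1 \<and> tree_on V2 R2"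
proof -
  let ?R = "R1 \<union> R2"
  have sR: "sym ?R" using s by (rule sym_Un)
  have 1: "(a, b) \<in> ?R\<^sup>* \<longleftrightarrow> (a, b) \<in> R1\<^sup>*" if "a \<in> V1" for a b
    using rtrancl_Un_disjoint[OF R dis that] .
  have 2: "(a, b) \<in> ?R\<^sup>* \<longleftrightarrow> (a, b) \<in> R2\<^sup>*" if "a \<in> V2" for a b
    using rtrancl_Un_disjoint[OF R(2,1) _ that, of b] dis by (simp add: Un_commute Int_commute)
  have st1: "a = b \<or> b \<in> V1" if "(a, b) \<in> R1\<^sup>*" for a b
    using rtrancl_stays[OF that R(1)] by auto
  have st2: "a = b \<or> b \<in> V2" if "(a, b) \<in> R2\<^sup>*" for a b
    using rtrancl_stays[OF that R(2)] by auto
  have uv: "(u, v) \<notin> ?R\<^sup>*" "(u, v) \<notin> ?R"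
    using 1[OF u] st1[of u v] u v dis by auto
  have ac: "acyclic_edges (edge u v \<union> ?R) \<longleftrightarrow> acyclic_edges R1 \<and> acyclic_edges R2"
    using acyclic_edges_edge_Un[OF sR uv(2)] acyclic_edges_Un_disjoint[OF R dis] uv by auto
  have conn: "(\<forall>a\<in>V1 \<union> V2. \<forall>b\<in>V1 \<union> V2. (a, b) \<in> (edge u v \<union> ?R)\<^sup>*) \<longleftrightarrow>
      (\<forall>a\<in>V1. \<forall>b\<in>V1. (a, b) \<in> R1\<^sup>*) \<and> (\<forall>a\<in>V2. \<forall>b\<in>V2. (a, b) \<in> R2\<^sup>*)" (is "?L \<longleftrightarrow> ?M")
  proof
    assume L: ?L
    have "(a, b) \<in> R1\<^sup>*" if ab: "a \<in> V1" "b \<in> V1" for a b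
      using L[rule_format, of a b] ab u v dis 1[of a] 1[of b] 2[OF v] st2[of v b] st1[of a v]
      unfolding rtrancl_edge_Un by auto
    moreover have "(a, b) \<in> R2\<^sup>*" if ab: "a \<in> V2" "b \<in> V2" for a b
      using L[rule_format, of a b] ab u v dis 2[of a] 2[of b] 1[OF u] st1[of u b] st2[of a u]
      unfolding rtrancl_edge_Un by auto
    ultimately show ?M by blast
  next
    assume ?M
    then show ?L
      unfolding rtrancl_edge_Un using 1 2 u v by blast
  qed
  have "edge u v \<union> ?R \<subseteq> (V1 \<union> V2) \<times> (V1 \<union> V2)" "sym (edge u v \<union> ?R)"
    using R u v sR by (auto simp: edge_def sym_def)
  then show ?thesis
    unfolding tree_on_def ac conn using R u v s by auto
qed

lemma acyclic_edges_empty [simp]: "acyclic_edges {}"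
  by (simp add: acyclic_edges_def)

lemma tree_on_singleton: "tree_on {v} R \<longleftrightarrow> R = {}"
proof
  assume "tree_on {v} R"
  then have "R \<subseteq> {(v, v)}" "acyclic_edges R" by (auto simp: tree_on_def)
  then show "R = {}" unfolding acyclic_edges_def by blast
next
  show "R = {} \<Longrightarrow> tree_on {v} R" by (simp add: tree_on_def sym_def)
qed

lemma tree_on_pendant:
  assumes "u \<in> V" "v \<notin> V" "R \<subseteq> V \<times> V" "sym R"
  shows "tree_on (insert v V) (edge u v \<union> R) \<longleftrightarrow> tree_on V R"
  using tree_on_bridge[of R V "{}" "{v}" u v] assms by (simp add: tree_on_singleton sym_def)

text \<open>
Both sides are acyclic precisely when \<open>R\<close> is acyclic and does not connect \<open>u\<close> with \<open>w\<close>,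
and a path \<open>u - x - w\<close> connects the same old vertices as an edge \<open>u - w\<close>.
\<close>

lemma tree_on_subdivide:
  assumes V: "u \<in> V" "w \<in> V" "u \<noteq> w" "x \<notin> V" and R: "R \<subseteq> V \<times> V" "sym R" "(u, w) \<notin> R"
  shows "tree_on (insert x V) (edge u x \<union> (edge x w \<union> R)) \<longleftrightarrow> tree_on V (edge u w \<union> R)"
proof -
  have sx: "sym (edge x w \<union> R)" using R by (auto intro: sym_Un)
  have x1: "(x, b) \<in> R\<^sup>* \<longleftrightarrow> b = x" "(b, x) \<in> R\<^sup>* \<longleftrightarrow> b = x" for b
    using rtrancl_stays[OF _ R(1), of x b] rtrancl_stays[OF _ R(1), of b x] V by auto
  have "acyclic_edges (edge u x \<union> (edge x w \<union> R)) \<longleftrightarrow>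
      acyclic_edges (edge x w \<union> R) \<and> (u, x) \<notin> (edge x w \<union> R)\<^sup>*"
    by (rule acyclic_edges_edge_Un[OF sx]) (use V R in \<open>auto simp: edge_def\<close>)
  moreover have "acyclic_edges (edge x w \<union> R) \<longleftrightarrow> acyclic_edges R \<and> (x, w) \<notin> R\<^sup>*"
    by (rule acyclic_edges_edge_Un[OF R(2)]) (use V R in auto)
  moreover have "acyclic_edges (edge u w \<union> R) \<longleftrightarrow> acyclic_edges R \<and> (u, w) \<notin> R\<^sup>*"
    by (rule acyclic_edges_edge_Un) (use V R in auto)
  ultimately have ac: "acyclic_edges (edge u x \<union> (edge x w \<union> R)) \<longleftrightarrow> acyclic_edges (edge u w \<union> R)"
    using V x1 by (auto simp: rtrancl_edge_Un)
  have uu: "(a, b) \<in> R\<^sup>*" if "(a, u) \<in> R\<^sup>*" "(u, b) \<in> R\<^sup>*" for a b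
    using that by (rule rtrancl_trans)
  have ww: "(a, b) \<in> R\<^sup>*" if "(a, w) \<in> R\<^sup>*" "(w, b) \<in> R\<^sup>*" for a b
    using that by (rule rtrancl_trans)
  have conn: "(\<forall>a\<in>insert x V. \<forall>b\<in>insert x V. (a, b) \<in> (edge u x \<union> (edge x w \<union> R))\<^sup>*) \<longleftrightarrow>
      (\<forall>a\<in>V. \<forall>b\<in>V. (a, b) \<in> (edge u w \<union> R)\<^sup>*)" (is "?L \<longleftrightarrow> ?M")
  proof
    assume ?L
    then show ?M
      unfolding rtrancl_edge_Un x1 using V by (auto; metis uu ww)
  next
    assume M: ?M
    have "(a, u) \<in> R\<^sup>* \<or> (a, w) \<in> R\<^sup>*" "(u, a) \<in> R\<^sup>* \<or> (w, a) \<in> R\<^sup>*" if "a \<in> V" for a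
      using M[rule_format, of a u] M[rule_format, of u a] V that unfolding rtrancl_edge_Un by auto
    with M show ?L
      unfolding rtrancl_edge_Un x1 using V by auto
  qed
  have "edge u x \<union> (edge x w \<union> R) \<subseteq> insert x V \<times> insert x V" "sym (edge u x \<union> (edge x w \<union> R))"
    "edge u w \<union> R \<subseteq> V \<times> V" "sym (edge u w \<union> R)"
    using V R by (auto simp: edge_def sym_def)
  then show ?thesis
    unfolding tree_on_def ac conn using V by auto
qed

section \<open>Counting the trees on a vertex set\<close>

lemma tree_on_irrefl: "tree_on V R \<Longrightarrow> (v, v) \<notin> R"
  unfolding tree_on_def acyclic_edges_def by blast

lemma edge_subset: "sym E \<Longrightarrow> (u, v) \<in> E \<Longrightarrow> edge u v \<subseteq> E"
  by (auto simp: edge_def dest: symD)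

text \<open>
A spanning tree has to use the only edge between the two parts. Apart from that edge it is a
pair of arbitrary trees.
\<close>

lemma trees_bridge:
  assumes E: "sym E" and dis: "V1 \<inter> V2 = {}" and b: "E \<inter> V1 \<times> V2 = {(u, v)}"
  shows "trees (V1 \<union> V2) E = (\<lambda>(R1, R2). edge u v \<union> (R1 \<union> R2)) ` (trees V1 E \<times> trees V2 E)"
    (is "_ = ?f ` _")
proof (intro equalityI subsetI)
  have uv: "u \<in> V1" "v \<in> V2" "(u, v) \<in> E" using b by auto
  fix R assume "R \<in> trees (V1 \<union> V2) E"
  then have RE: "R \<subseteq> E" and t: "tree_on (V1 \<union> V2) R" by (auto simp: trees_def)
  define R1 R2 where "R1 = R \<inter> V1 \<times> V1" and "R2 = R \<inter> V2 \<times> V2"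
  have RV: "R \<subseteq> (V1 \<union> V2) \<times> (V1 \<union> V2)" "sym R" using t by (auto simp: tree_on_def)
  have cross: "R \<inter> V1 \<times> V2 \<subseteq> {(u, v)}" using RE b by auto
  have cross': "R \<inter> V2 \<times> V1 \<subseteq> {(v, u)}"
    using cross RV(2) by (auto dest: symD)
  have split: "R = (R \<inter> edge u v) \<union> (R1 \<union> R2)"
    using RV cross cross' unfolding R1_def R2_def edge_def by blast
  have sub: "R1 \<subseteq> V1 \<times> V1" "R2 \<subseteq> V2 \<times> V2" by (auto simp: R1_def R2_def)
  have s: "sym R1" "sym R2" using RV(2) by (auto simp: R1_def R2_def sym_def)
  have "(u, v) \<in> R"
  proof (rule ccontr)
    assume "(u, v) \<notin> R"
    then have "R = R1 \<union> R2" using split RV(2) by (auto simp: edge_def dest: symD)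
    moreover have "(u, v) \<in> R\<^sup>*" using t uv by (auto simp: tree_on_def)
    ultimately have "(u, v) \<in> R1\<^sup>*"
      using rtrancl_Un_disjoint[OF sub dis uv(1)] by simp
    then show False using rtrancl_stays[OF _ sub(1)] uv dis by blast
  qed
  then have R: "R = edge u v \<union> (R1 \<union> R2)"
    using split edge_subset[OF RV(2)] by auto
  then have "tree_on V1 R1 \<and> tree_on V2 R2"
    using t tree_on_bridge[OF sub dis uv(1,2) s] by simp
  then have "(R1, R2) \<in> trees V1 E \<times> trees V2 E"
    using RE by (auto simp: trees_def R1_def R2_def)
  then show "R \<in> ?f ` (trees V1 E \<times> trees V2 E)"
    using R by (auto intro: rev_image_eqI)
next
  have uv: "u \<in> V1" "v \<in> V2" "(u, v) \<in> E" using b by auto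
  fix R assume "R \<in> ?f ` (trees V1 E \<times> trees V2 E)"
  then obtain R1 R2 where R: "R = edge u v \<union> (R1 \<union> R2)" "R1 \<in> trees V1 E" "R2 \<in> trees V2 E"
    by auto
  then have "tree_on (V1 \<union> V2) R"
    using tree_on_bridge[of R1 V1 R2 V2 u v] dis uv by (auto simp: trees_def tree_on_def)
  then show "R \<in> trees (V1 \<union> V2) E"
    using R edge_subset[OF E uv(3)] by (auto simp: trees_def)
qed

lemma card_trees_bridge:
  assumes "sym E" "V1 \<inter> V2 = {}" "E \<inter> V1 \<times> V2 = {(u, v)}"
  shows "card (trees (V1 \<union> V2) E) = card (trees V1 E) * card (trees V2 E)"
proof -
  have uv: "u \<in> V1" "v \<in> V2" using assms(3) by auto
  have "inj_on (\<lambda>(R1, R2). edge u v \<union> (R1 \<union> R2)) (trees V1 E \<times> trees V2 E)"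
  proof (rule inj_on_inverseI[where g = "\<lambda>R. (R \<inter> V1 \<times> V1, R \<inter> V2 \<times> V2)"])
    fix p assume p: "p \<in> trees V1 E \<times> trees V2 E"
    obtain R1 R2 where [simp]: "p = (R1, R2)" by (cases p)
    have "R1 \<subseteq> V1 \<times> V1" "R2 \<subseteq> V2 \<times> V2" using p by (auto simp: trees_def tree_on_def)
    then show "(\<lambda>R. (R \<inter> V1 \<times> V1, R \<inter> V2 \<times> V2)) ((\<lambda>(R1, R2). edge u v \<union> (R1 \<union> R2)) p) = p"
      using uv assms(2) by (simp add: edge_def) blast
  qed
  then show ?thesis
    by (simp add: trees_bridge[OF assms] card_image card_cartesian_product)
qed

lemma trees_singleton: "trees {v} E = {{}}"
  by (auto simp: trees_def tree_on_singleton)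

text \<open>
A tree in which \<open>v\<close> is a leaf is determined by the neighbour of \<open>v\<close> and by the tree left
when \<open>v\<close> is removed, and both can be chosen freely.
\<close>

lemma card_trees_leaf:
  assumes E: "sym E" and v: "v \<notin> V"
  shows "card {R \<in> trees (insert v V) E. card (R `` {v}) = 1} = card {u \<in> V. (v, u) \<in> E} * card (trees V E)"
proof -
  let ?f = "\<lambda>(u, R). edge u v \<union> R"
  let ?D = "{u \<in> V. (v, u) \<in> E} \<times> trees V E"
  have nb: "(edge u v \<union> R) `` {v} = {u}" if "R \<in> trees V E" "u \<in> V" for u R
    using that v by (auto simp: trees_def tree_on_def edge_def)
  have "{R \<in> trees (insert v V) E. card (R `` {v}) = 1} = ?f ` ?D"
  proof (intro equalityI subsetI)
    fix R assume "R \<in> {R \<in> trees (insert v V) E. card (R `` {v}) = 1}"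
    then have RE: "R \<subseteq> E" and t: "tree_on (insert v V) R" and c: "card (R `` {v}) = 1"
      by (auto simp: trees_def)
    from c obtain u where u: "R `` {v} = {u}" by (auto simp: card_1_singleton_iff)
    have RV: "R \<subseteq> insert v V \<times> insert v V" "sym R" using t by (auto simp: tree_on_def)
    have vu: "(v, u) \<in> R" using u by auto
    then have uV: "u \<in> V" using RV tree_on_irrefl[OF t, of v] by auto
    define R0 where "R0 = R \<inter> V \<times> V"
    have nb_u: "a = u" if "(a, v) \<in> R \<or> (v, a) \<in> R" for a
      using that u RV(2) by (auto dest: symD)
    have R: "R = edge u v \<union> R0"
    proof (intro equalityI subsetI)
      fix p assume "p \<in> R"
      moreover obtain a b where "p = (a, b)" by (cases p)
      ultimately show "p \<in> edge u v \<union> R0"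
        using nb_u[of a] nb_u[of b] RV(1) uV v by (auto simp: R0_def edge_def)
    next
      fix p assume "p \<in> edge u v \<union> R0"
      then show "p \<in> R"
        using edge_subset[OF RV(2) vu] by (auto simp: R0_def edge_commute)
    qed
    have R0: "R0 \<subseteq> V \<times> V" "sym R0"
      using RV(2) by (auto simp: R0_def sym_def)
    have "tree_on V R0"
      using t R tree_on_pendant[OF uV v R0] by simp
    then have "(u, R0) \<in> ?D" using RE vu uV by (auto simp: trees_def R0_def)
    then show "R \<in> ?f ` ?D" using R by (auto intro: rev_image_eqI)
  next
    fix R assume "R \<in> ?f ` ?D"
    then obtain u R0 where R: "R = edge u v \<union> R0" "u \<in> V" "(v, u) \<in> E" "R0 \<in> trees V E" by auto
    then have "tree_on (insert v V) R"
      using tree_on_pendant[OF R(2) v, of R0] by (auto simp: trees_def tree_on_def)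
    moreover have "R \<subseteq> E"
      using R edge_subset[OF E R(3)] by (auto simp: trees_def edge_commute)
    ultimately show "R \<in> {R \<in> trees (insert v V) E. card (R `` {v}) = 1}"
      using nb[OF R(4,2)] R by (auto simp: trees_def)
  qed
  moreover have "inj_on ?f ?D"
  proof (rule inj_on_inverseI[where g = "\<lambda>R. (the_elem (R `` {v}), R \<inter> V \<times> V)"])
    fix p assume p: "p \<in> ?D"
    obtain u R where [simp]: "p = (u, R)" by (cases p)
    have "(edge u v \<union> R) \<inter> V \<times> V = R"
      using p v by (auto simp: trees_def tree_on_def edge_def)
    then show "(\<lambda>R. (the_elem (R `` {v}), R \<inter> V \<times> V)) (?f p) = p"
      using nb[of R u] p by simp
  qed
  ultimately show ?thesis
    by (simp add: card_image card_cartesian_product)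
qed

text \<open>
The new edges \<open>u - x\<close>, \<open>x - y\<close> and \<open>y - w\<close> form a path from \<open>u\<close> to \<open>w\<close>. A tree cannot
omit two of them, since this would cut off \<open>x\<close>, \<open>y\<close> or both from \<open>V\<close>. If it omits exactly one, then
the other two hang onto a tree on \<open>V\<close>: this gives the cases \<open>A\<close>, \<open>B\<close> and \<open>C\<close>. If it has all
three, they arise by subdividing the edge \<open>u - w\<close> of a tree on \<open>V\<close> twice, which is case
\<open>D\<close>.
\<close>

lemma card_trees_append_square:
  assumes E: "sym E" and fin: "finite V" and V: "u \<in> V" "w \<in> V" "u \<noteq> w" "x \<notin> V" "y \<notin> V" "x \<noteq> y"
    and e: "(u, w) \<in> E" "(x, y) \<in> E" "{a \<in> V. (x, a) \<in> E} = {u}" "{a \<in> V. (y, a) \<in> E} = {w}"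
  defines "T \<equiv> trees V E" and "T' \<equiv> trees (insert x (insert y V)) E"
  shows "card {R \<in> T'. (x, y) \<notin> R} = card T"
    and "card {R \<in> T'. (x, y) \<in> R} = 2 * card T + card {R \<in> T. (u, w) \<in> R}"
proof -
  define A where "A = (\<lambda>R. edge u x \<union> (edge w y \<union> R))"
  define B where "B = (\<lambda>R. edge y x \<union> (edge w y \<union> R))"
  define C where "C = (\<lambda>R. edge x y \<union> (edge u x \<union> R))"
  define D where "D = (\<lambda>R. edge u x \<union> (edge x y \<union> (edge y w \<union> (R - edge u w))))"
  let ?W = "insert x (insert y V)"
  let ?S = "{R \<in> T. (u, w) \<in> R}"
  have eE: "edge u x \<subseteq> E" "edge w y \<subseteq> E" "edge x y \<subseteq> E" "edge y w \<subseteq> E" "edge y x \<subseteq> E" "edge u w \<subseteq> E"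
    using e by (auto intro!: edge_subset[OF E] intro: symD[OF E])
  have T: "R \<subseteq> V \<times> V" "sym R" "R \<subseteq> E" "tree_on V R" if "R \<in> T" for R
    using that by (auto simp: T_def trees_def tree_on_def)
  have tA: "tree_on ?W (A R) \<longleftrightarrow> tree_on V R" if "R \<subseteq> V \<times> V" "sym R" for R
    using tree_on_pendant[of u "insert y V" x "edge w y \<union> R"] tree_on_pendant[of w V y R] V that
    by (auto simp: edge_def sym_def A_def)
  have tB: "tree_on ?W (B R) \<longleftrightarrow> tree_on V R" if "R \<subseteq> V \<times> V" "sym R" for R
    using tree_on_pendant[of y "insert y V" x "edge w y \<union> R"] tree_on_pendant[of w V y R] V that
    by (auto simp: edge_def sym_def B_def)
  have tC: "tree_on ?W (C R) \<longleftrightarrow> tree_on V R" if "R \<subseteq> V \<times> V" "sym R" for R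
    using tree_on_pendant[of x "insert x V" y "edge u x \<union> R"] tree_on_pendant[of u V x R] V that
    by (auto simp: edge_def sym_def insert_commute C_def)
  have tD: "tree_on ?W (edge u x \<union> (edge x y \<union> (edge y w \<union> R))) \<longleftrightarrow> tree_on V (edge u w \<union> R)"
    if "R \<subseteq> V \<times> V" "sym R" "(u, w) \<notin> R" for R
  proof -
    have "tree_on ?W (edge u x \<union> (edge x y \<union> (edge y w \<union> R))) \<longleftrightarrow>
        tree_on (insert y V) (edge u y \<union> (edge y w \<union> R))"
      by (rule tree_on_subdivide) (use V that in \<open>auto simp: edge_def sym_def\<close>)
    also have "\<dots> \<longleftrightarrow> tree_on V (edge u w \<union> R)"
      by (rule tree_on_subdivide) (use V that in auto)
    finally show ?thesis .
  qed
  have D_eq: "edge u w \<union> (R - edge u w) = R" if "R \<in> ?S" for R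
    using that T(2)[of R] edge_subset[of R u w] by auto

  have cases: "(x, y) \<notin> R \<and> R \<in> A ` T \<or> (x, y) \<in> R \<and> R \<in> B ` T \<union> C ` T \<union> D ` ?S"
    if "R \<in> T'" for R
  proof -
    have RE: "R \<subseteq> E" and t: "tree_on ?W R" using that by (auto simp: T'_def trees_def)
    have RW: "R \<subseteq> ?W \<times> ?W" "sym R" and conn: "\<And>a b. a \<in> ?W \<Longrightarrow> b \<in> ?W \<Longrightarrow> (a, b) \<in> R\<^sup>*"
      using t by (auto simp: tree_on_def)
    define R0 where "R0 = R \<inter> V \<times> V"
    have R0: "R0 \<subseteq> V \<times> V" "sym R0" "R0 \<subseteq> E" using RW RE by (auto simp: R0_def sym_def)
    have nbx: "a = u" if "(x, a) \<in> R \<or> (a, x) \<in> R" "a \<in> V" for a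
      using that e(3) RE RW(2) by (auto dest: symD)
    have nby: "a = w" if "(y, a) \<in> R \<or> (a, y) \<in> R" "a \<in> V" for a
      using that e(4) RE RW(2) by (auto dest: symD)
    have split: "R = (R \<inter> edge u x) \<union> (R \<inter> edge w y) \<union> (R \<inter> edge x y) \<union> R0"
    proof (intro equalityI subsetI)
      fix p assume p: "p \<in> R"
      obtain a b where [simp]: "p = (a, b)" by (cases p)
      have "a \<in> ?W" "b \<in> ?W" "a \<noteq> b" using p RW tree_on_irrefl[OF t] by auto
      then show "p \<in> (R \<inter> edge u x) \<union> (R \<inter> edge w y) \<union> (R \<inter> edge x y) \<union> R0"
        using p nbx[of a] nbx[of b] nby[of a] nby[of b] by (auto simp: R0_def edge_def)
    qed (auto simp: R0_def)
    have int: "R \<inter> edge a b = (if (a, b) \<in> R then edge a b else {})" for a b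
      using RW(2) by (auto simp: edge_def dest: symD)
    note split = split[unfolded int]
    have isolated: "z = z'" if "R \<subseteq> Z \<times> Z" "z \<notin> Z" "z \<in> ?W" "z' \<in> ?W" for z z' Z
      using rtrancl_stays[OF conn that(1)] that by blast
    have x1: "(u, x) \<in> R \<or> (x, y) \<in> R"
    proof (rule ccontr)
      assume "\<not> ?thesis"
      then have "R \<subseteq> insert y V \<times> insert y V"
        using split R0 V by (auto simp: edge_def split: if_splits)
      from isolated[OF this, of x u] V show False by auto
    qed
    have y1: "(w, y) \<in> R \<or> (x, y) \<in> R"
    proof (rule ccontr)
      assume "\<not> ?thesis"
      then have "R \<subseteq> insert x V \<times> insert x V"
        using split R0 V by (auto simp: edge_def split: if_splits)
      from isolated[OF this, of y u] V show False by auto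
    qed
    have ux_or_wy: "(u, x) \<in> R \<or> (w, y) \<in> R"
    proof (rule ccontr)
      assume "\<not> ?thesis"
      then have "R \<subseteq> edge x y \<union> R0" using split by (auto split: if_splits)
      with conn[of x u] have "(x, u) \<in> (edge x y \<union> R0)\<^sup>*"
        using V(1) rtrancl_mono by blast
      then show False
        using rtrancl_stays[OF _ R0(1)] V unfolding rtrancl_edge_Un by metis
    qed
    have inT: "R0 \<in> T" if "tree_on V R0" using that R0 by (auto simp: T_def trees_def)
    show ?thesis
    proof (cases "(x, y) \<in> R")
      case False
      then have R: "R = A R0" using split x1 y1 by (auto simp: A_def)
      then have "R0 \<in> T" using t tA[OF R0(1,2)] inT by simp
      then show ?thesis using R False by blast
    next
      case xy: True
      consider "(u, x) \<notin> R" "(w, y) \<in> R" | "(u, x) \<in> R" "(w, y) \<notin> R" | "(u, x) \<in> R" "(w, y) \<in> R"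
        using ux_or_wy by blast
      then show ?thesis
      proof cases
        case 1
        then have R: "R = B R0" using split xy by (auto simp: B_def edge_commute)
        then have "R0 \<in> T" using t tB[OF R0(1,2)] inT by simp
        then show ?thesis using R xy by blast
      next
        case 2
        then have R: "R = C R0" using split xy by (auto simp: C_def)
        then have "R0 \<in> T" using t tC[OF R0(1,2)] inT by simp
        then show ?thesis using R xy by blast
      next
        case 3
        let ?P = "edge x y \<union> (edge y w \<union> R0)"
        have R: "R = edge u x \<union> ?P" using split xy 3 by (auto simp: edge_def)
        \<comment> \<open>Otherwise \<open>u - w - y - x\<close> would be a path around the edge \<open>u - x\<close>.\<close>
        have uw: "(u, w) \<notin> R0"
        proof
          assume "(u, w) \<in> R0"
          then have "(u, x) \<in> ?P\<^sup>*"
            by (intro converse_rtrancl_into_rtrancl[of u w] converse_rtrancl_into_rtrancl[of w y]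
                r_into_rtrancl) (auto simp: edge_def)
          moreover have "acyclic_edges (edge u x \<union> ?P) \<longleftrightarrow> acyclic_edges ?P \<and> (u, x) \<notin> ?P\<^sup>*"
            by (rule acyclic_edges_edge_Un) (use V R0 in \<open>auto simp: edge_def sym_def\<close>)
          ultimately show False using t R by (simp add: tree_on_def)
        qed
        then have "tree_on V (edge u w \<union> R0)" using t tD[OF R0(1,2)] R by simp
        then have "edge u w \<union> R0 \<in> ?S"
          using R0 eE by (auto simp: T_def trees_def edge_def)
        moreover have "(edge u w \<union> R0) - edge u w = R0"
          using uw R0(2) by (auto simp: edge_def dest: symD)
        ultimately have "R \<in> D ` ?S" using R by (intro image_eqI[where x = "edge u w \<union> R0"]) (simp_all add: D_def)
        then show ?thesis using xy by blast
      qed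
    qed
  qed

  have memA: "A R \<in> T' \<and> (x, y) \<notin> A R" if "R \<in> T" for R
    using T[OF that] tA[of R] eE V by (auto simp: A_def T'_def trees_def edge_def)
  have memB: "B R \<in> T' \<and> (x, y) \<in> B R \<and> (u, x) \<notin> B R \<and> (w, y) \<in> B R" if "R \<in> T" for R
    using T[OF that] tB[of R] eE V by (auto simp: B_def T'_def trees_def edge_def)
  have memC: "C R \<in> T' \<and> (x, y) \<in> C R \<and> (u, x) \<in> C R \<and> (w, y) \<notin> C R" if "R \<in> T" for R
    using T[OF that] tC[of R] eE V by (auto simp: C_def T'_def trees_def edge_def)
  have memD: "D R \<in> T' \<and> (x, y) \<in> D R \<and> (u, x) \<in> D R \<and> (w, y) \<in> D R" if "R \<in> ?S" for R
  proof -
    have R: "R - edge u w \<subseteq> V \<times> V" "sym (R - edge u w)" "(u, w) \<notin> R - edge u w"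
      using T[of R] that by (auto simp: edge_def sym_def)
    have "tree_on ?W (D R)"
      using tD[OF R] D_def D_eq[OF that] T(4)[of R] that by simp
    moreover have "D R \<subseteq> E" using eE T(3)[of R] that unfolding D_def by blast
    ultimately show ?thesis by (auto simp: T'_def trees_def edge_def D_def)
  qed

  have rec: "A R \<inter> V \<times> V = R" "B R \<inter> V \<times> V = R" "C R \<inter> V \<times> V = R" if "R \<in> T" for R
    using V T(1)[OF that] by (auto simp: A_def B_def C_def edge_def)
  have injA: "inj_on A T" and injB: "inj_on B T" and injC: "inj_on C T"
    by (rule inj_on_inverseI[where g = "\<lambda>X. X \<inter> V \<times> V"]; use rec in simp)+
  have injD: "inj_on D ?S"
  proof (rule inj_on_inverseI[where g = "\<lambda>X. edge u w \<union> X \<inter> V \<times> V"])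
    fix R assume R: "R \<in> ?S"
    then have "D R \<inter> V \<times> V = R - edge u w"
      using V T(1)[of R] by (auto simp: D_def edge_def)
    then show "edge u w \<union> D R \<inter> V \<times> V = R" using D_eq[OF R] by simp
  qed

  have "{R \<in> T'. (x, y) \<notin> R} = A ` T"
    using memA memB memC memD cases by blast
  then show "card {R \<in> T'. (x, y) \<notin> R} = card T"
    using injA by (simp add: card_image)
  have "{R \<in> T'. (x, y) \<in> R} = B ` T \<union> C ` T \<union> D ` ?S"
    using memA memB memC memD cases by blast
  moreover have "B ` T \<inter> C ` T = {}" "(B ` T \<union> C ` T) \<inter> D ` ?S = {}"
    using memB memC memD by blast+
  moreover have "finite T" using fin by (simp add: T_def finite_trees)
  ultimately show "card {R \<in> T'. (x, y) \<in> R} = 2 * card T + card ?S"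
    using injB injC injD by (simp add: card_Un_disjoint card_image)
qed

section \<open>Spanning trees and leaves as relations\<close>

lemma pcas_last: "pcas u p v \<Longrightarrow> v \<in> set (pawalk_verts u p)"
  by (induction p arbitrary: u) auto

text \<open>
A walk that misses \<open>w\<close> does not use an edge at \<open>w\<close>. This turns the remainder of a cycle
into a path around one of its edges.
\<close>

lemma pcas_avoiding:
  assumes "pcas x p u" "set p \<subseteq> R" "w \<notin> set (pawalk_verts x p)"
  shows "(x, u) \<in> (R - edge u w)\<^sup>*"
  using assms
proof (induction p arbitrary: x)
  case (Cons e p)
  have "w \<noteq> snd e" using Cons.prems(1,3) by (cases p) auto
  then have "(x, snd e) \<in> R - edge u w"
    using Cons.prems by (cases e) (auto simp: edge_def)
  moreover have "(snd e, u) \<in> (R - edge u w)\<^sup>*"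
    using Cons by auto
  ultimately show ?case by (rule converse_rtrancl_into_rtrancl)
qed simp

text \<open>
The vertex set of the auxiliary digraph is the whole type, so that reachability in it is
just the reflexive transitive closure.
\<close>

lemma rtrancl_simple_path:
  assumes "(u, v) \<in> S\<^sup>*"
  obtains p where "pcas u p v" "set p \<subseteq> S" "distinct (pawalk_verts u p)"
proof -
  interpret H: pair_wf_digraph "\<lparr>pverts = UNIV, parcs = S\<rparr>"
    by unfold_locales auto
  have "u \<rightarrow>\<^sup>*\<^bsub>with_proj \<lparr>pverts = UNIV, parcs = S\<rparr>\<^esub> v"
    using assms by (simp add: H.reachable_conv)
  then obtain p where "H.apath u p v"
    using H.reachable_apath by auto
  then show ?thesis
    using that by (auto simp: H.apath_def H.awalk_def)
qed

text \<open>
A simple path around an edge has length at least two and closes up with the edge to a cycle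
of length at least three. Conversely, the remainder of such a cycle is a path around its first
edge: it leaves the head of that edge by an arc to a third vertex and does not return to it.
\<close>

lemma acyclic_edges_iff_no_cycle:
  assumes "pair_graph T"
  shows "acyclic_edges (parcs T) \<longleftrightarrow> \<not> (\<exists>p. pre_digraph.cycle (with_proj T) p \<and> 3 \<le> length p)"
proof -
  interpret pair_graph T by fact
  have sym: "(a, b) \<in> parcs T \<Longrightarrow> (b, a) \<in> parcs T" for a b
    using graph_symmetric by simp
  have "\<exists>p. cycle p \<and> 3 \<le> length p"
    if uv: "(u, v) \<in> parcs T" and path: "(u, v) \<in> (parcs T - edge u v)\<^sup>*" for u v
  proof -
    obtain p where p: "pcas u p v" "set p \<subseteq> parcs T - edge u v" "distinct (pawalk_verts u p)"
      using rtrancl_simple_path[OF path] .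
    have "u \<noteq> v" using uv pair_no_loops by force
    then have "2 \<le> length p"
      using p by (cases p; cases "tl p") (auto simp: edge_def)
    moreover have "cycle ((v, u) # p)"
      unfolding cycle_def awalk_def
      using p uv sym[OF uv] in_arcsD1[OF sym[OF uv]] by auto
    ultimately show ?thesis by (intro exI[of _ "(v, u) # p"]) auto
  qed
  moreover have "\<not> acyclic_edges (parcs T)" if c: "cycle p" "3 \<le> length p" for p
  proof -
    obtain u where u: "set p \<subseteq> parcs T" "pcas u p u" "distinct (tl (pawalk_verts u p))"
      using c(1) unfolding cycle_def awalk_def by auto
    obtain e f g q where p: "p = e # f # g # q"
      using c(2) by (auto simp: numeral_eq_Suc Suc_le_length_iff)
    obtain w x where e: "e = (u, w)" and f: "f = (w, x)"
      using u(2) p by (cases e; cases f) auto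
    let ?r = "g # q"
    have r: "pcas x ?r u" "set ?r \<subseteq> parcs T" "w \<notin> set (pawalk_verts x ?r)" "distinct (pawalk_verts x ?r)"
      using u p e f by auto
    have "x \<noteq> u"
      using r(1,4) pcas_last[of "snd g" q u] by auto
    moreover have "w \<noteq> u" using u(1) p e pair_no_loops by force
    ultimately have "(w, x) \<in> parcs T - edge u w"
      using u(1) p f by (auto simp: edge_def)
    moreover have "(x, u) \<in> (parcs T - edge u w)\<^sup>*"
      using pcas_avoiding[OF r(1-3)] .
    ultimately have "(w, u) \<in> (parcs T - edge w u)\<^sup>*"
      by (metis edge_commute converse_rtrancl_into_rtrancl)
    moreover have "(w, u) \<in> parcs T" using sym u(1) p e by auto
    ultimately show ?thesis unfolding acyclic_edges_def by blast
  qed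
  ultimately show ?thesis
    unfolding acyclic_edges_def by blast
qed

lemma pair_graph_iff:
  "pair_graph T \<longleftrightarrow> finite (pverts T) \<and> parcs T \<subseteq> pverts T \<times> pverts T \<and> sym (parcs T) \<and> irrefl (parcs T)"
proof
  assume "pair_graph T"
  then interpret pair_graph T .
  show "finite (pverts T) \<and> parcs T \<subseteq> pverts T \<times> pverts T \<and> sym (parcs T) \<and> irrefl (parcs T)"
    using pair_finite_verts wellformed' sym_arcs pair_no_loops
    by (force simp: symmetric_def irrefl_def)
next
  assume *: "finite (pverts T) \<and> parcs T \<subseteq> pverts T \<times> pverts T \<and> sym (parcs T) \<and> irrefl (parcs T)"
  then have "finite (parcs T)" by (meson finite_SigmaI finite_subset)
  with * show "pair_graph T"
    by unfold_locales (auto simp: symmetric_def irrefl_def)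
qed

lemma simple_tree_iff_tree_on:
  "simple_tree T \<longleftrightarrow> finite (pverts T) \<and> tree_on (pverts T) (parcs T)"
proof (cases "pair_graph T")
  case True
  then interpret pair_graph T .
  have "(\<Union>e\<in>parcs T. {(fst e, snd e), (snd e, fst e)}) = parcs T"
    using graph_symmetric by force
  then have "mk_symmetric (with_proj T) = T"
    by (simp add: mk_symmetric_def)
  then have "Digraph_Component.connected (with_proj T) \<longleftrightarrow>
      pverts T \<noteq> {} \<and> (\<forall>a\<in>pverts T. \<forall>b\<in>pverts T. (a, b) \<in> (parcs T)\<^sup>*)"
    by (simp add: Digraph_Component.connected_def strongly_connected_def reachable_conv)
  then show ?thesis
    using True acyclic_edges_iff_no_cycle[OF True]
    by (auto simp: simple_tree_def tree_on_def pair_graph_iff)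
next
  case False
  have "irrefl (parcs T)" if "tree_on (pverts T) (parcs T)"
    using that unfolding irrefl_def tree_on_def acyclic_edges_def by blast
  then show ?thesis
    using False by (auto simp: simple_tree_def tree_on_def pair_graph_iff)
qed

lemma bij_betw_spanning_trees:
  assumes "pair_graph G"
  shows "bij_betw parcs (spanning_trees G) (trees (pverts G) (parcs G))"
proof (rule bij_betw_byWitness[where f' = "\<lambda>R. \<lparr>pverts = pverts G, parcs = R\<rparr>"])
  interpret pair_graph G by fact
  show "\<forall>T\<in>spanning_trees G. \<lparr>pverts = pverts G, parcs = parcs T\<rparr> = T"
    by (auto simp: spanning_trees_def spanning_def)
  show "parcs ` spanning_trees G \<subseteq> trees (pverts G) (parcs G)"
    by (auto simp: spanning_trees_def spanning_def subgraph_def simple_tree_iff_tree_on trees_def)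
  show "(\<lambda>R. \<lparr>pverts = pverts G, parcs = R\<rparr>) ` trees (pverts G) (parcs G) \<subseteq> spanning_trees G"
  proof clarify
    fix R assume R: "R \<in> trees (pverts G) (parcs G)"
    let ?T = "\<lparr>pverts = pverts G, parcs = R\<rparr>"
    have "simple_tree ?T"
      using R pair_finite_verts by (simp add: simple_tree_iff_tree_on trees_def)
    moreover from this interpret T: pair_graph ?T by (simp add: simple_tree_def)
    have "spanning (with_proj ?T) (with_proj G)"
      using R wf_digraph_axioms T.wf_digraph_axioms
      by (auto simp: spanning_def subgraph_def trees_def)
    ultimately show "?T \<in> spanning_trees G"
      by (simp add: spanning_trees_def)
  qed
qed simp

lemma leaves_eq: "leaves T = {v \<in> pverts T. card (parcs T `` {v}) = 1}"
proof -
  have "out_arcs (with_proj T) v = Pair v ` (parcs T `` {v})" for v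
    by (auto simp: out_arcs_def)
  then have "out_degree (with_proj T) v = card (parcs T `` {v})" for v
    by (simp add: out_degree_def card_image inj_on_def)
  then show ?thesis by (simp add: leaves_def)
qed

text \<open>
Double counting of the pairs of a spanning tree and one of its leaves.
\<close>

lemma sum_card_leaves:
  assumes "pair_graph G"
  shows "(\<Sum>T\<in>spanning_trees G. card (leaves T)) =
    (\<Sum>v\<in>pverts G. card {R \<in> trees (pverts G) (parcs G). card (R `` {v}) = 1})"
proof -
  interpret pair_graph G by fact
  have "(\<Sum>T\<in>spanning_trees G. card (leaves T)) =
      (\<Sum>T\<in>spanning_trees G. card {v \<in> pverts G. card (parcs T `` {v}) = 1})"
    by (rule sum.cong) (auto simp: leaves_eq spanning_trees_def spanning_def)
  also have "\<dots> = (\<Sum>R\<in>trees (pverts G) (parcs G). card {v \<in> pverts G. card (R `` {v}) = 1})"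
    by (rule sum.reindex_bij_betw[OF bij_betw_spanning_trees[OF assms]])
  also have "\<dots> = (\<Sum>v\<in>pverts G. card {R \<in> trees (pverts G) (parcs G). card (R `` {v}) = 1})"
    by (rule sum_multicount_gen) (auto simp: finite_trees pair_finite_verts)
  finally show ?thesis .
qed

section \<open>Spanning trees of the ladder\<close>

text \<open>
The adjacency of the infinite grid, of which the ladders are induced subgraphs.
\<close>

definition grid :: "(nat \<times> nat) rel" where
  "grid = {(u, v). \<bar>int (fst u) - int (fst v)\<bar> = 1 \<and> snd u = snd v \<or>
                   fst u = fst v \<and> \<bar>int (snd u) - int (snd v)\<bar> = 1}"

text \<open>
The rungs \<open>i\<close> to \<open>j\<close> of the ladder. Deleting a vertex leaves a ladder that starts at a
higher rung; an arbitrary first rung avoids shifting it back by an isomorphism.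
\<close>

definition ladder :: "nat \<Rightarrow> nat \<Rightarrow> (nat \<times> nat) set" where
  "ladder i j = {1..2} \<times> {i..j}"

text \<open>
The number of spanning trees of the ladder with \<open>n\<close> rungs, for \<open>n \<ge> 1\<close>. The value \<open>0\<close> at
\<open>n = 0\<close> continues the recursion backwards.
\<close>

definition ladder_count :: "nat \<Rightarrow> real" where
  "ladder_count n = ((2 + sqrt 3) ^ n - (2 - sqrt 3) ^ n) / (2 * sqrt 3)"

lemma sym_grid: "sym grid"
  by (auto simp: grid_def sym_def)

lemma grid_iff: "((r, i), (s, j)) \<in> grid \<longleftrightarrow>
    (r = Suc s \<or> s = Suc r) \<and> i = j \<or> r = s \<and> (i = Suc j \<or> j = Suc i)"
  by (auto simp: grid_def)

lemma ladder_iff: "(r, k) \<in> ladder i j \<longleftrightarrow> (r = 1 \<or> r = 2) \<and> i \<le> k \<and> k \<le> j"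
  by (auto simp: ladder_def)

lemma finite_ladder: "finite (ladder i j)"
  by (simp add: ladder_def)

lemma ladder_count_0: "ladder_count 0 = 0"
  by (simp add: ladder_count_def)

lemma ladder_count_1: "ladder_count (Suc 0) = 1"
  by (simp add: ladder_count_def)

lemma ladder_count_rec: "ladder_count (Suc (Suc n)) = 4 * ladder_count (Suc n) - ladder_count n"
proof -
  have sq: "(2 + sqrt 3) * (2 + sqrt 3) = 4 * (2 + sqrt 3) - 1" "(2 - sqrt 3) * (2 - sqrt 3) = 4 * (2 - sqrt 3) - 1"
    by (simp_all add: algebra_simps)
  have "(2 + sqrt 3) ^ Suc (Suc n) = 4 * (2 + sqrt 3) ^ Suc n - (2 + sqrt 3) ^ n"
    "(2 - sqrt 3) ^ Suc (Suc n) = 4 * (2 - sqrt 3) ^ Suc n - (2 - sqrt 3) ^ n"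
    unfolding power_Suc mult.assoc[symmetric] sq by (simp_all add: algebra_simps)
  then show ?thesis
    by (simp only: ladder_count_def) (simp add: diff_divide_distrib)
qed

lemma trees_rung: "trees (ladder i i) grid = {edge (1, i) (2, i)}"
proof -
  have "ladder i i = {(1, i)} \<union> {(2, i)}" by (auto simp: ladder_iff)
  moreover have "trees ({(1, i)} \<union> {(2, i)}) grid =
      (\<lambda>(R1, R2). edge (1, i) (2, i) \<union> (R1 \<union> R2)) ` (trees {(1, i)} grid \<times> trees {(2, i)} grid)"
    by (rule trees_bridge) (auto simp: sym_grid grid_iff)
  ultimately show ?thesis by (simp add: trees_singleton)
qed

lemma card_trees_ladder_Suc:
  fixes i j :: nat
  assumes "i \<le> j"
  defines "T \<equiv> trees (ladder i j) grid" and "T' \<equiv> trees (ladder i (Suc j)) grid"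
  shows "card {R \<in> T'. ((1, Suc j), (2, Suc j)) \<in> R} = 2 * card T + card {R \<in> T. ((1, j), (2, j)) \<in> R}"
    and "card T' = 3 * card T + card {R \<in> T. ((1, j), (2, j)) \<in> R}"
proof -
  have T': "T' = trees (insert (1, Suc j) (insert (2, Suc j) (ladder i j))) grid"
    unfolding T'_def by (rule arg_cong[where f = "\<lambda>V. trees V grid"]) (use assms in \<open>auto simp: ladder_iff\<close>)
  have nb: "{a \<in> ladder i j. ((r, Suc j), a) \<in> grid} = {(r, j)}" if "r = 1 \<or> r = 2" for r
    using that assms(1) by (auto simp: ladder_iff grid_iff)
  note square = card_trees_append_square[OF sym_grid finite_ladder, of "(1, j)" i j "(2, j)" "(1, Suc j)" "(2, Suc j)",
      folded T_def T']
  have with_rung: "card {R \<in> T'. ((1, Suc j), (2, Suc j)) \<in> R} = 2 * card T + card {R \<in> T. ((1, j), (2, j)) \<in> R}"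
    by (rule square(2)) (use assms(1) nb in \<open>auto simp: ladder_iff grid_iff\<close>)
  have without: "card {R \<in> T'. ((1, Suc j), (2, Suc j)) \<notin> R} = card T"
    by (rule square(1)) (use assms(1) nb in \<open>auto simp: ladder_iff grid_iff\<close>)
  have "finite T'" by (simp add: T'_def finite_trees finite_ladder)
  then have "card T' = card {R \<in> T'. ((1, Suc j), (2, Suc j)) \<in> R} + card {R \<in> T'. ((1, Suc j), (2, Suc j)) \<notin> R}"
    by (subst card_Un_disjoint[symmetric]) (auto intro: arg_cong[where f = card])
  with with_rung without show "card T' = 3 * card T + card {R \<in> T. ((1, j), (2, j)) \<in> R}" by simp
  show "card {R \<in> T'. ((1, Suc j), (2, Suc j)) \<in> R} = 2 * card T + card {R \<in> T. ((1, j), (2, j)) \<in> R}"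
    by (fact with_rung)
qed

text \<open>
A tree without the last rung arises in a unique way from a tree of the ladder with one rung less.
The number of trees that contain the last rung is thus the difference of two successive counts,
which makes the recursion for the two counts one of second order for \<^const>\<open>ladder_count\<close>.
\<close>

lemma card_trees_ladder_aux:
  "real (card (trees (ladder i (i + m)) grid)) = ladder_count (Suc m) \<and>
   real (card {R \<in> trees (ladder i (i + m)) grid. ((1, i + m), (2, i + m)) \<in> R}) =
     ladder_count (Suc m) - ladder_count m"
proof (induction m)
  case 0
  have "{R \<in> trees (ladder i i) grid. ((1, i), (2, i)) \<in> R} = {edge (1, i) (2, i)}"
    by (auto simp: trees_rung edge_def)
  then show ?case by (simp add: trees_rung ladder_count_0 ladder_count_1)
next
  case (Suc m)
  then show ?case
    using card_trees_ladder_Suc[of i "i + m"] by (simp add: ladder_count_rec)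
qed

lemma card_trees_ladder:
  assumes "i \<le> j"
  shows "real (card (trees (ladder i j) grid)) = ladder_count (Suc j - i)"
  using card_trees_ladder_aux[of i "j - i"] assms by (simp add: Suc_diff_le)

text \<open>
Removing \<open>(r, k)\<close> leaves the other end \<open>(s, k)\<close> of its rung attached by one bridge to each of
the two remaining ladders.
\<close>

lemma card_trees_leaf_interior:
  assumes r: "r = 1 \<or> r = 2" and k: "1 < k" "k < n"
  shows "real (card {R \<in> trees (ladder 1 n) grid. card (R `` {(r, k)}) = 1}) =
    3 * (ladder_count (k - 1) * ladder_count (n - k))"
proof -
  define s where "s = 3 - r"
  have s: "(r = 1 \<and> s = 2) \<or> (r = 2 \<and> s = 1)" using r by (auto simp: s_def)
  obtain j where j: "k = Suc j" "1 \<le> j" using k by (cases k) auto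
  let ?L = "ladder 1 j" and ?R = "ladder (Suc k) n"
  let ?V = "?L \<union> ({(s, k)} \<union> ?R)"
  have V: "ladder 1 n = insert (r, k) ?V"
  proof (rule set_eqI)
    fix p :: "nat \<times> nat"
    obtain a b where "p = (a, b)" by (cases p)
    then show "p \<in> ladder 1 n \<longleftrightarrow> p \<in> insert (r, k) ?V"
      using s k j by (auto simp: ladder_iff)
  qed
  have "{u \<in> ?V. ((r, k), u) \<in> grid} = {(r, j), (r, Suc k), (s, k)}"
    using s k j by (auto simp: ladder_iff grid_iff)
  moreover have "card {(r, j), (r, Suc k), (s, k)} = 3"
    using s j by auto
  moreover have "card (trees ?V grid) = card (trees ?L grid) * card (trees ({(s, k)} \<union> ?R) grid)"
    by (rule card_trees_bridge[where u = "(s, j)" and v = "(s, k)"])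
      (use s k j in \<open>auto simp: ladder_iff grid_iff sym_grid\<close>)
  moreover have "card (trees ({(s, k)} \<union> ?R) grid) = card (trees {(s, k)} grid) * card (trees ?R grid)"
    by (rule card_trees_bridge[where u = "(s, k)" and v = "(s, Suc k)"])
      (use s k j in \<open>auto simp: ladder_iff grid_iff sym_grid\<close>)
  moreover have "card {R \<in> trees (insert (r, k) ?V) grid. card (R `` {(r, k)}) = 1} =
      card {u \<in> ?V. ((r, k), u) \<in> grid} * card (trees ?V grid)"
    by (rule card_trees_leaf) (use s j in \<open>auto simp: ladder_iff sym_grid\<close>)
  ultimately have "card {R \<in> trees (ladder 1 n) grid. card (R `` {(r, k)}) = 1} =
      3 * (card (trees ?L grid) * card (trees ?R grid))"
    unfolding V by (simp add: trees_singleton)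
  then show ?thesis
    using card_trees_ladder[of 1 j] card_trees_ladder[of "Suc k" n] k j by simp
qed

section \<open>The limit\<close>

lemma ladder_count_pos: "0 < ladder_count (Suc n)"
proof -
  have "\<bar>2 - sqrt 3\<bar> < 2 + sqrt 3" by (simp add: abs_less_iff)
  then have "\<bar>2 - sqrt 3\<bar> ^ Suc n < (2 + sqrt 3) ^ Suc n"
    by (rule power_strict_mono) auto
  then have "(2 - sqrt 3) ^ Suc n < (2 + sqrt 3) ^ Suc n"
    by (metis abs_ge_self order_le_less_trans power_abs)
  then show ?thesis by (simp add: ladder_count_def)
qed

text \<open>
With \<open>\<alpha> = 2 + sqrt 3\<close> and \<open>\<beta> = 2 - sqrt 3\<close>, the product of the \<open>k\<close>-th and the
\<open>(N - k)\<close>-th term expands into \<open>\<alpha>^N\<close> and \<open>\<beta>^N\<close>, which do not depend on \<open>k\<close>, and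
mixed terms. The sum of the mixed terms \<open>\<alpha>^k * \<beta>^(N - k)\<close> is
\<open>(\<alpha>^(N + 1) - \<beta>^(N + 1)) / (\<alpha> - \<beta>)\<close>.
\<close>

lemma ladder_count_convolution:
  "12 * (\<Sum>k\<le>N. ladder_count k * ladder_count (N - k)) =
     real (Suc N) * ((2 + sqrt 3) ^ N + (2 - sqrt 3) ^ N) - 2 * ladder_count (Suc N)"
proof -
  let ?a = "2 + sqrt 3" and ?b = "2 - sqrt 3"
  have pw: "x ^ k * x ^ (N - k) = x ^ N" if "k \<le> N" for x :: real and k
    using that by (simp flip: power_add)
  have "12 * (ladder_count k * ladder_count (N - k)) =
      (?a ^ N + ?b ^ N) - ?a ^ k * ?b ^ (N - k) - ?a ^ (N - k) * ?b ^ k" if "k \<le> N" for k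
  proof -
    have "12 * (ladder_count k * ladder_count (N - k)) =
        (?a ^ k - ?b ^ k) * (?a ^ (N - k) - ?b ^ (N - k))"
      by (simp add: ladder_count_def)
    also have "\<dots> = ?a ^ k * ?a ^ (N - k) + ?b ^ k * ?b ^ (N - k) - ?a ^ k * ?b ^ (N - k) - ?a ^ (N - k) * ?b ^ k"
      by (simp only: algebra_simps)
    finally show ?thesis by (simp only: pw[OF that])
  qed
  then have "12 * (\<Sum>k\<le>N. ladder_count k * ladder_count (N - k)) =
      (\<Sum>k\<le>N. (?a ^ N + ?b ^ N) - ?a ^ k * ?b ^ (N - k) - ?a ^ (N - k) * ?b ^ k)"
    unfolding sum_distrib_left by (intro sum.cong) auto
  also have "\<dots> = real (Suc N) * (?a ^ N + ?b ^ N) - (\<Sum>k\<le>N. ?a ^ k * ?b ^ (N - k)) - (\<Sum>k\<le>N. ?a ^ (N - k) * ?b ^ k)"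
    by (simp only: sum_subtractf sum_constant card_atMost)
  also have "(\<Sum>k\<le>N. ?a ^ (N - k) * ?b ^ k) = (\<Sum>k\<le>N. ?a ^ k * ?b ^ (N - k))"
    by (rule sum.reindex_bij_witness[of _ "\<lambda>k. N - k" "\<lambda>k. N - k"]) auto
  also have "(\<Sum>k\<le>N. ?a ^ k * ?b ^ (N - k)) = ladder_count (Suc N)"
  proof -
    have "?a ^ Suc N - ?b ^ Suc N = (?a - ?b) * (\<Sum>k\<le>N. ?a ^ k * ?b ^ (N - k))"
      unfolding diff_power_eq_sum lessThan_Suc_atMost by simp
    then show ?thesis by (simp add: ladder_count_def)
  qed
  finally show ?thesis by simp
qed

lemma pverts_grid_graph: "pverts (grid_graph 2 n) = ladder 1 n"
  by (simp add: grid_graph_def ladder_def)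

lemma trees_grid_graph: "trees (pverts (grid_graph 2 n)) (parcs (grid_graph 2 n)) = trees (ladder 1 n) grid"
proof -
  have "parcs (grid_graph 2 n) = grid \<inter> ladder 1 n \<times> ladder 1 n"
    unfolding grid_graph_def grid_def ladder_def by auto
  then show ?thesis
    unfolding pverts_grid_graph by (auto simp: trees_def tree_on_def)
qed

lemma card_spanning_trees_grid_graph:
  "real (card (spanning_trees (grid_graph 2 (Suc n)))) = ladder_count (Suc n)"
  using bij_betw_same_card[OF bij_betw_spanning_trees[OF pair_graph_grid_graph]]
    card_trees_ladder[of 1 "Suc n"]
  by (simp add: trees_grid_graph)

text \<open>
The four corners of the ladder account for the difference between the bounds. Each of them is a
leaf of at most all trees.
\<close>

lemma sum_leaves_bounds:
  fixes m :: nat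
  defines "L \<equiv> real (\<Sum>T\<in>spanning_trees (grid_graph 2 (m + 2)). card (leaves T))"
    and "S \<equiv> 6 * (\<Sum>k\<le>m + 1. ladder_count k * ladder_count (m + 1 - k))"
  shows "S \<le> L" "L \<le> S + 4 * ladder_count (m + 2)"
proof -
  let ?n = "m + 2"
  define c where "c r k = real (card {R \<in> trees (ladder 1 ?n) grid. card (R `` {(r, k)}) = 1})" for r k :: nat
  have "L = (\<Sum>v\<in>{1..2} \<times> {1..?n}. c (fst v) (snd v))"
    unfolding L_def sum_card_leaves[OF pair_graph_grid_graph] trees_grid_graph
    by (simp add: pverts_grid_graph c_def ladder_def)
  also have "\<dots> = (\<Sum>r\<in>{1..2}. \<Sum>k\<in>{1..?n}. c r k)"
    unfolding sum.cartesian_product by (rule sum.cong) auto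
  also have "\<dots> = (\<Sum>k\<in>{1..?n}. c 1 k) + (\<Sum>k\<in>{1..?n}. c 2 k)"
    by (simp add: numeral_2_eq_2)
  finally have L: "L = (\<Sum>k\<in>{1..?n}. c 1 k) + (\<Sum>k\<in>{1..?n}. c 2 k)" .
  have row: "(\<Sum>k\<in>{1..?n}. c r k) = c r 1 + c r ?n + S / 2" if r: "r = 1 \<or> r = 2" for r
  proof -
    have "{1..?n} = insert 1 (insert ?n {2..m + 1})" by auto
    then have "(\<Sum>k\<in>{1..?n}. c r k) = c r 1 + c r ?n + (\<Sum>k\<in>{2..m + 1}. c r k)"
      by simp
    also have "(\<Sum>k\<in>{2..m + 1}. c r k) = (\<Sum>k\<in>{2..m + 1}. 3 * (ladder_count (k - 1) * ladder_count (?n - k)))"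
      by (rule sum.cong) (use r card_trees_leaf_interior[of r _ ?n] in \<open>auto simp: c_def\<close>)
    also have "\<dots> = (\<Sum>k\<in>{1..m}. 3 * (ladder_count k * ladder_count (m + 1 - k)))"
      by (rule sum.reindex_bij_witness[of _ Suc "\<lambda>k. k - 1"]) auto
    \<comment> \<open>The two terms added here vanish because \<^const>\<open>ladder_count\<close> is zero at zero.\<close>
    also have "\<dots> = (\<Sum>k\<le>m + 1. 3 * (ladder_count k * ladder_count (m + 1 - k)))"
    proof (rule sum.mono_neutral_left)
      show "\<forall>i\<in>{..m + 1} - {1..m}. 3 * (ladder_count i * ladder_count (m + 1 - i)) = 0"
      proof
        fix i assume "i \<in> {..m + 1} - {1..m}"
        then have "i = 0 \<or> i = m + 1" by auto
        then show "3 * (ladder_count i * ladder_count (m + 1 - i)) = 0"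
          by (auto simp: ladder_count_0)
      qed
    qed auto
    also have "\<dots> = S / 2" by (simp add: S_def sum_distrib_left[symmetric])
    finally show ?thesis .
  qed
  have c: "0 \<le> c r k" "c r k \<le> ladder_count ?n" for r k
  proof -
    have "c r k \<le> real (card (trees (ladder 1 ?n) grid))"
      unfolding c_def by (intro of_nat_mono card_mono) (auto simp: finite_trees finite_ladder)
    then show "c r k \<le> ladder_count ?n" using card_trees_ladder[of 1 ?n] by simp
  qed (simp add: c_def)
  have "L = S + (c 1 1 + c 1 ?n + c 2 1 + c 2 ?n)"
    unfolding L using row[of 1] row[of 2] by simp
  then show "S \<le> L" "L \<le> S + 4 * ladder_count ?n"
    using c(1)[of 1 1] c(1)[of 1 ?n] c(1)[of 2 1] c(1)[of 2 ?n]
      c(2)[of 1 1] c(2)[of 1 ?n] c(2)[of 2 1] c(2)[of 2 ?n] by linarith+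
qed

text \<open>
Divide numerator and denominator by \<open>(2 + sqrt 3) ^ N\<close>.
\<close>

lemma main_term_limit:
  "(\<lambda>N. ((2 + sqrt 3) ^ N + (2 - sqrt 3) ^ N) / (4 * ladder_count (Suc N))) \<longlonglongrightarrow> sqrt 3 - 3 / 2"
proof -
  let ?a = "2 + sqrt 3" and ?b = "2 - sqrt 3"
  let ?q = "?b / ?a"
  have a: "?a > 0" by (simp add: add_pos_pos)
  then have a0: "?a \<noteq> 0" by (rule less_imp_neq[symmetric])
  have cancel: "s / 2 * ((1 + y / x) / (c - d * (y / x))) = (x + y) / (4 * ((c * x - d * y) / (2 * s)))"
    if "x \<noteq> 0" "s \<noteq> 0" for c d s x y :: real
  proof -
    define z where "z = c * x - d * y"
    have "1 + y / x = (x + y) / x" "c - d * (y / x) = z / x"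
      using that by (simp_all add: z_def field_simps)
    then have "s / 2 * ((1 + y / x) / (c - d * (y / x))) = (x + y) / (4 * (z / (2 * s)))"
      using that by (cases "z = 0") (simp_all add: field_simps)
    then show ?thesis by (simp only: z_def)
  qed
  have "\<bar>?b\<bar> < ?a" by (simp add: abs_less_iff)
  then have "\<bar>?q\<bar> < 1"
    unfolding abs_divide abs_of_pos[OF a] by (subst divide_less_eq_1_pos[OF a])
  then have q: "(\<lambda>N. ?q ^ N) \<longlonglongrightarrow> 0" by (rule LIMSEQ_abs_realpow_zero2)
  have "(\<lambda>N. sqrt 3 / 2 * ((1 + ?q ^ N) / (?a - ?b * ?q ^ N))) \<longlonglongrightarrow> sqrt 3 / 2 * ((1 + 0) / (?a - ?b * 0))"
    by (intro tendsto_intros q) (simp add: a0)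
  also have "sqrt 3 / 2 * ((1 + 0) / (?a - ?b * 0)) = sqrt 3 - 3 / 2"
  proof -
    have ne: "2 * ?a \<noteq> 0" using a0 by (metis mult_eq_0_iff zero_neq_numeral)
    have "(sqrt 3 - 3 / 2) * (2 * ?a) = sqrt 3" by (simp add: algebra_simps)
    then have "sqrt 3 / (2 * ?a) = sqrt 3 - 3 / 2"
      unfolding nonzero_divide_eq_eq[OF ne] by (rule sym)
    then show ?thesis by simp
  qed
  also have "(\<lambda>N. sqrt 3 / 2 * ((1 + ?q ^ N) / (?a - ?b * ?q ^ N))) =
      (\<lambda>N. (?a ^ N + ?b ^ N) / (4 * ladder_count (Suc N)))"
  proof
    fix N
    show "sqrt 3 / 2 * ((1 + ?q ^ N) / (?a - ?b * ?q ^ N)) = (?a ^ N + ?b ^ N) / (4 * ladder_count (Suc N))"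
      unfolding ladder_count_def power_Suc power_divide by (rule cancel) (simp_all add: a0)
  qed
  finally show ?thesis .
qed

text \<open>
Let \<open>n\<close> be the number of rungs. Divided by \<open>2 * n * ladder_count n\<close>, six times the convolution is the
main term minus \<open>1 / (2 * n)\<close>, and the corners add at most \<open>2 / n\<close>.
\<close>

lemma leaf_ratio_limit:
  "(\<lambda>n. real (\<Sum>T\<in>spanning_trees (grid_graph 2 n). card (leaves T)) /
      (2 * real n * real (card (spanning_trees (grid_graph 2 n))))) \<longlonglongrightarrow> sqrt 3 - 3 / 2"
    (is "?ratio \<longlonglongrightarrow> _")
proof -
  define g where "g m = ((2 + sqrt 3) ^ (m + 1) + (2 - sqrt 3) ^ (m + 1)) / (4 * ladder_count (Suc (m + 1)))" for m
  have g: "g \<longlonglongrightarrow> sqrt 3 - 3 / 2"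
    using LIMSEQ_ignore_initial_segment[OF main_term_limit, of 1] unfolding g_def by simp
  have inv: "(\<lambda>m. c / real (m + 2)) \<longlonglongrightarrow> 0" for c
    using LIMSEQ_ignore_initial_segment[OF lim_const_over_n[of c], of 2] .
  have alg: "(r * (2 * t * x) - t) / (2 * r * t) = x - (1 / 2) / r"
    "(r * (2 * t * x) - t + 4 * t) / (2 * r * t) = x - (1 / 2) / r + 2 / r"
    if "r > 0" "t > 0" for r t x :: real
    using that by (simp_all add: field_simps)
  have bounds: "g m - (1 / 2) / real (m + 2) \<le> ?ratio (m + 2)"
    "?ratio (m + 2) \<le> g m - (1 / 2) / real (m + 2) + 2 / real (m + 2)" for m
  proof -
    let ?t = "ladder_count (m + 2)"
    let ?S = "6 * (\<Sum>k\<le>m + 1. ladder_count k * ladder_count (m + 1 - k))"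
    have t: "0 < ?t" using ladder_count_pos[of "m + 1"] by simp
    have card: "real (card (spanning_trees (grid_graph 2 (m + 2)))) = ?t"
      using card_spanning_trees_grid_graph[of "m + 1"] by simp
    define u where "u = (2 + sqrt 3) ^ (m + 1) + (2 - sqrt 3) ^ (m + 1)"
    have Suc: "Suc (m + 1) = m + 2" by simp
    have "g m = u / (4 * ?t)"
      unfolding g_def u_def Suc ..
    then have "u = 4 * ?t * g m" using t by simp
    moreover have "2 * ?S = real (m + 2) * u - 2 * ?t"
      using ladder_count_convolution[of "m + 1"] unfolding u_def[symmetric] Suc by simp
    ultimately have S_eq: "?S = real (m + 2) * (2 * ?t * g m) - ?t"
      by (simp only: algebra_simps)
    have S: "?S / (2 * real (m + 2) * ?t) = g m - (1 / 2) / real (m + 2)"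
      and S4: "(?S + 4 * ?t) / (2 * real (m + 2) * ?t) = g m - (1 / 2) / real (m + 2) + 2 / real (m + 2)"
      unfolding S_eq by (rule alg; use t in simp)+
    show "g m - (1 / 2) / real (m + 2) \<le> ?ratio (m + 2)"
      unfolding S[symmetric] card using sum_leaves_bounds(1)[of m] t
      by (intro divide_right_mono) auto
    show "?ratio (m + 2) \<le> g m - (1 / 2) / real (m + 2) + 2 / real (m + 2)"
      unfolding S4[symmetric] card using sum_leaves_bounds(2)[of m] t
      by (intro divide_right_mono) auto
  qed
  have low: "(\<lambda>m. g m - (1 / 2) / real (m + 2)) \<longlonglongrightarrow> sqrt 3 - 3 / 2"
    using tendsto_diff[OF g inv[of "1 / 2"]] by simp
  have "(\<lambda>m. ?ratio (m + 2)) \<longlonglongrightarrow> sqrt 3 - 3 / 2"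
    by (rule tendsto_sandwich[OF _ _ low])
      (use bounds tendsto_add[OF low inv[of 2]] in \<open>auto intro!: always_eventually simp del: of_nat_add\<close>)
  then show ?thesis by (rule LIMSEQ_offset)
qed

theorem theorem7p0p1:
  shows "has_BZ_constant {grid_graph 2 n | n. 1 \<le> n} (sqrt 3 - 3 / 2) \<and>
    (\<lambda>n. real (\<Sum>T\<in>spanning_trees (grid_graph 2 n). card (leaves T)) /
          (2 * real n * real (card (spanning_trees (grid_graph 2 n)))))
      \<longlonglongrightarrow> sqrt 3 - 3 / 2"
proof
  have BZ: "BZ_ratio (grid_graph 2 n) = real (\<Sum>T\<in>spanning_trees (grid_graph 2 n). card (leaves T)) /
      (2 * real n * real (card (spanning_trees (grid_graph 2 n))))" for n
    by (simp add: BZ_ratio_def pverts_grid_graph ladder_def)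
  show "has_BZ_constant {grid_graph 2 n | n. 1 \<le> n} (sqrt 3 - 3 / 2)"
    unfolding has_BZ_constant_def
  proof (rule topological_tendstoI)
    fix U :: "real set" assume "open U" "sqrt 3 - 3 / 2 \<in> U"
    then have "\<forall>\<^sub>F n in sequentially. BZ_ratio (grid_graph 2 n) \<in> U"
      using topological_tendstoD[OF leaf_ratio_limit] by (simp add: BZ)
    then obtain N where N: "\<And>n. N \<le> n \<Longrightarrow> BZ_ratio (grid_graph 2 n) \<in> U"
      by (auto simp: eventually_sequentially)
    have "\<forall>\<^sub>F G in filtercomap (\<lambda>G :: (nat \<times> nat) pair_pre_digraph. card (pverts G)) at_top.
        2 * N \<le> card (pverts G)"
      by (rule eventually_filtercomapI) (rule eventually_ge_at_top)
    then show "\<forall>\<^sub>F G in inf (filtercomap (\<lambda>G. card (pverts G)) at_top)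
        (principal {grid_graph 2 n | n. 1 \<le> n}). BZ_ratio G \<in> U"
      unfolding eventually_inf_principal
      \<comment> \<open>A ladder with at least \<open>2 * N\<close> vertices has at least \<open>N\<close> rungs.\<close>
      by (rule eventually_mono) (use N in \<open>auto simp: pverts_grid_graph ladder_def\<close>)
  qed
qed (fact leaf_ratio_limit)

end
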